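(* Let $n\ge 2$ and let $f$ be a Möbius transformation with $f(\mathbb{H}^n)=\mathbb{B}^n$. Then for all $x,y\in\mathbb{H}^n$, $$\frac13\,u_{\mathbb{H}^n}(x,y)\le u_{\mathbb{B}^n}(f(x),f(y))\le 3\,u_{\mathbb{H}^n}(x,y),$$ and the left-hand inequality is sharp, i.e. the constant $\frac13$ cannot be replaced by any larger constant so that it holds for all such $f$ and all $x,y\in\mathbb{H}^n$.
   Context: $\overline{\mathbb{R}}^n=\mathbb{R}^n\cup\{\infty\}$; a Möbius transformation of $\overline{\mathbb{R}}^n$ is a finite composition of reflections (inversions) in spheres and hyperplanes. $\mathbb{B}^n=\{z\in\mathbb{R}^n:|z|<1\}$ and $\mathbb{H}^n=\{x=(x_1,\dots,x_n)\in\mathbb{R}^n:x_n>0\}$. For a domain $D\subsetneq\mathbb{R}^n$ and $x\in D$, $d(x)$ denotes the Euclidean distance from $x$ to the boundary of $D$ in $\mathbb{R}^n$, and the Gromov hyperbolic metric $u_D$ is $$u_D(x,y)=2\log\frac{|x-y|+\max\{d(x),d(y)\}}{\sqrt{d(x)\,d(y)}},\qquad x,y\in D.$$ Thus $d(x)=1-|x|$ for $D=\mathbb{B}^n$ and $d(x)=x_n$ for $D=\mathbb{H}^n$. *)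

theory Defs
  imports "HOL-Analysis.Analysis"
begin

text \<open>The one-point compactification of \<open>'a\<close> is \<open>'a option\<close>, with \<open>None\<close> as the point at
  infinity (the convention of \<open>Alexandroff_compactification\<close>).\<close>

definition sphere_reflection ::
    "'a::euclidean_space \<Rightarrow> real \<Rightarrow> 'a option \<Rightarrow> 'a option" where
  "sphere_reflection a r z =
     (case z of
        None \<Rightarrow> Some a
      | Some x \<Rightarrow> if x = a then None
                  else Some (a + (r\<^sup>2 / (norm (x - a))\<^sup>2) *\<^sub>R (x - a)))"

text \<open>Reflection in the hyperplane \<open>{x. v \<bullet> x = t}\<close>; the normal \<open>v\<close> need not be a unit vector.\<close>

definition hyperplane_reflection ::
    "'a::euclidean_space \<Rightarrow> real \<Rightarrow> 'a option \<Rightarrow> 'a option" where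
  "hyperplane_reflection v t z =
     (case z of
        None \<Rightarrow> None
      | Some x \<Rightarrow> Some (x - (2 * (v \<bullet> x - t) / (norm v)\<^sup>2) *\<^sub>R v))"

inductive moebius_transformation :: "('a::euclidean_space option \<Rightarrow> 'a option) \<Rightarrow> bool" where
  sphere: "r > 0 \<Longrightarrow> moebius_transformation (sphere_reflection a r)"
| hyperplane: "v \<noteq> 0 \<Longrightarrow> moebius_transformation (hyperplane_reflection v t)"
| comp: "moebius_transformation f \<Longrightarrow> moebius_transformation g \<Longrightarrow> moebius_transformation (f \<circ> g)"

text \<open>The coordinate singled out is an arbitrary \<open>k\<close>, since an index type \<open>'n\<close> has no
  distinguished last element.\<close>

definition upper_half_space :: "'n::finite \<Rightarrow> (real ^ 'n) set" where
  "upper_half_space k = {x. x $ k > 0}"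

definition boundary_dist :: "'a::euclidean_space set \<Rightarrow> 'a \<Rightarrow> real" where
  "boundary_dist D x = infdist x (frontier D)"

text \<open>Meaningful for a domain \<open>D \<noteq> UNIV\<close> (so that \<open>frontier D\<close> is nonempty) and \<open>x, y \<in> D\<close>.\<close>

definition gromov_metric :: "'a::euclidean_space set \<Rightarrow> 'a \<Rightarrow> 'a \<Rightarrow> real" where
  "gromov_metric D x y =
     2 * ln ((norm (x - y) + max (boundary_dist D x) (boundary_dist D y)) /
             sqrt (boundary_dist D x * boundary_dist D y))"

text \<open>Moebius transformations \<open>f\<close> of the compactified space with \<open>f(H) = B\<close>. For such \<open>f\<close> and
  \<open>x \<in> H\<close>, the point \<open>f(x)\<close> is finite and equals \<open>the (f (Some x))\<close>.\<close>

definition moebius_half_space_to_ball ::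
    "'n::finite \<Rightarrow> ((real ^ 'n) option \<Rightarrow> (real ^ 'n) option) \<Rightarrow> bool" where
  "moebius_half_space_to_ball k f \<longleftrightarrow>
     moebius_transformation f \<and> f ` (Some ` upper_half_space k) = Some ` ball 0 1"

end

theory Submission
  imports Defs
begin

text \<open>Both metrics are compared with one Moebius invariant. For \<open>x, y\<close> in the half-space put
  \<open>T = |x - y| / (2 * sqrt (x\<^sub>k * y\<^sub>k))\<close>, which is \<open>sinh (\<rho> / 2)\<close> for the hyperbolic distance \<open>\<rho>\<close>;
  since \<open>f\<close> is an isometry of the hyperbolic metrics,
  \<open>|f x - f y| = T * sqrt ((1 - |f x|\<^sup>2) * (1 - |f y|\<^sup>2))\<close>. Writing
  \<open>1 - |z|\<^sup>2 = d (2 - d)\<close> with \<open>d = 1 - |z|\<close> in the interval from 0 to 1, the Euclidean distance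
  of two points lies in both domains between \<open>T * sqrt (d\<^sub>1 * d\<^sub>2)\<close> and \<open>2 * T * sqrt (d\<^sub>1 * d\<^sub>2)\<close>,
  where \<open>d\<^sub>1, d\<^sub>2\<close> are the distances to the boundary. Since \<open>\<bar>d\<^sub>1 - d\<^sub>2\<bar>\<close> is at most the Euclidean
  distance of the points, this already gives \<open>1 + T \<le> exp (u / 2) \<le> (1 + T)\<^sup>3\<close> for either Gromov
  metric \<open>u\<close> (\<open>gromov_metric_bounds\<close>). So \<open>u\<close> is comparable to \<open>2 ln (1 + T)\<close> with constants 1
  and 3 on both sides of \<open>f\<close>, and both inequalities follow.

  The invariance of \<open>T\<close> (\<open>half_space_to_ball_invariant\<close>) is linear algebra in disguise. A Moebius
  transformation acts on the light cone of Lorentz space by a linear isometry followed by a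
  positive rescaling \<open>l\<close>. In coordinates: \<open>|f x - f y|\<^sup>2 = l(x) l(y) |x - y|\<^sup>2\<close>, and every
  function \<open>\<alpha> |x|\<^sup>2 + b \<bullet> x + \<gamma>\<close> pulls back, up to the factor \<open>l\<close>, to one of the same kind with
  the same \<open>|b|\<^sup>2 - 4 \<alpha> \<gamma>\<close>. The pullback of \<open>1 - |x|\<^sup>2\<close> is positive exactly on the half-space, so
  it must be \<open>2 x\<^sub>k\<close>, and dividing the two relations eliminates \<open>l\<close>.

  For sharpness, the reflection in the sphere of radius \<open>sqrt 2\<close> about \<open>-e\<^sub>k\<close> sends \<open>t e\<^sub>k\<close> and
  \<open>e\<^sub>k / t\<close> to antipodal points near the origin when \<open>t\<close> is close to 1; the metrics are then
  \<open>2 ln (2 t - 1/t)\<close> and \<open>2 ln t\<close>, whose quotient tends to 3 as \<open>t\<close> decreases to 1.\<close>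

section \<open>Conformal factors of Moebius transformations\<close>

text \<open>With \<open>Some x\<close> lifted to the light-like vector \<open>(x, |x|\<^sup>2, 1)\<close> and \<open>None\<close> to \<open>(0, 1, 0)\<close>, the
  separation is a fixed multiple of their Lorentz product. This dictates the values at infinity, and
  with them the transformation law in \<open>conformal_factor\<close> has no exceptional points.\<close>

definition separation :: "'a::euclidean_space option \<Rightarrow> 'a option \<Rightarrow> real" where
  "separation z w =
     (case (z, w) of
        (Some x, Some y) \<Rightarrow> (x - y) \<bullet> (x - y)
      | (None, None) \<Rightarrow> 0
      | _ \<Rightarrow> 1)"

text \<open>A linear functional on Lorentz space, restricted to the lifts of the points; this explains
  the value at infinity. Its discriminant is the Lorentz norm of the functional, and the zero set is
  a sphere or a hyperplane when the discriminant is positive.\<close>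

definition quadric :: "real \<Rightarrow> 'a::euclidean_space \<Rightarrow> real \<Rightarrow> 'a option \<Rightarrow> real" where
  "quadric \<alpha> b \<gamma> z = (case z of None \<Rightarrow> \<alpha> | Some x \<Rightarrow> \<alpha> * (x \<bullet> x) + b \<bullet> x + \<gamma>)"

definition discriminant :: "real \<Rightarrow> 'a::euclidean_space \<Rightarrow> real \<Rightarrow> real" where
  "discriminant \<alpha> b \<gamma> = b \<bullet> b - 4 * \<alpha> * \<gamma>"

text \<open>The coordinate form of the statement that \<open>f\<close> is induced by a linear Lorentz isometry: the
  second clause is invariance of the product on the light cone, the third says that the isometry
  also acts on linear functionals and keeps their norm. The same \<open>l\<close> has to serve in both clauses,
  so that it cancels in quotients.\<close>

definition conformal_factor ::
    "('a::euclidean_space option \<Rightarrow> 'a option) \<Rightarrow> ('a option \<Rightarrow> real) \<Rightarrow> bool" where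
  "conformal_factor f l \<longleftrightarrow>
     (\<forall>z. l z > 0) \<and>
     (\<forall>z w. separation (f z) (f w) = l z * l w * separation z w) \<and>
     (\<forall>\<alpha> b \<gamma>. \<exists>\<alpha>' b' \<gamma>'. discriminant \<alpha>' b' \<gamma>' = discriminant \<alpha> b \<gamma> \<and>
        (\<forall>z. quadric \<alpha> b \<gamma> (f z) = l z * quadric \<alpha>' b' \<gamma>' z))"

lemma inner_diff_swap: "(x - y) \<bullet> (x - y) = (y - x) \<bullet> (y - x)" for x y :: "'a::real_inner"
  by (simp add: inner_diff_left inner_diff_right inner_commute)

lemma separation_eq_0_iff: "separation z w = 0 \<longleftrightarrow> z = w"
  by (auto simp: separation_def split: option.splits)

text \<open>Injectivity turns the hypothesis on the image of the half-space into a statement about its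
  complement, where the pullback of \<open>1 - |x|\<^sup>2\<close> must fail to be positive.\<close>

lemma conformal_factor_inj:
  assumes "conformal_factor f l"
  shows "inj f"
proof (rule injI)
  fix z w assume "f z = f w"
  then have "l z * l w * separation z w = 0"
    using assms separation_eq_0_iff[of "f z" "f w"] unfolding conformal_factor_def by metis
  moreover have "l z > 0" "l w > 0"
    using assms unfolding conformal_factor_def by auto
  ultimately show "z = w"
    by (simp add: separation_eq_0_iff)
qed

lemma conformal_factor_comp:
  assumes f: "conformal_factor f l" and g: "conformal_factor g m"
  shows "conformal_factor (f \<circ> g) (\<lambda>z. l (g z) * m z)"
  unfolding conformal_factor_def
proof (intro conjI allI)
  show "l (g z) * m z > 0" for z
    using f g by (simp add: conformal_factor_def)
  show "separation ((f \<circ> g) z) ((f \<circ> g) w) = l (g z) * m z * (l (g w) * m w) * separation z w"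
    for z w
    using f g by (simp add: conformal_factor_def)
  fix \<alpha> \<gamma> :: real and b :: 'a
  obtain \<alpha>' b' \<gamma>' where 1: "discriminant \<alpha>' b' \<gamma>' = discriminant \<alpha> b \<gamma>"
      "\<And>z. quadric \<alpha> b \<gamma> (f z) = l z * quadric \<alpha>' b' \<gamma>' z"
    using f unfolding conformal_factor_def by metis
  obtain \<alpha>'' b'' \<gamma>'' where 2: "discriminant \<alpha>'' b'' \<gamma>'' = discriminant \<alpha>' b' \<gamma>'"
      "\<And>z. quadric \<alpha>' b' \<gamma>' (g z) = m z * quadric \<alpha>'' b'' \<gamma>'' z"
    using g unfolding conformal_factor_def by metis
  show "\<exists>\<alpha>' b' \<gamma>'. discriminant \<alpha>' b' \<gamma>' = discriminant \<alpha> b \<gamma> \<and>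
      (\<forall>z. quadric \<alpha> b \<gamma> ((f \<circ> g) z) = l (g z) * m z * quadric \<alpha>' b' \<gamma>' z)"
    using 1 2 by (intro exI[of _ \<alpha>''] exI[of _ b''] exI[of _ \<gamma>'']) simp
qed

text \<open>Away from the centre, \<open>l\<close> is the usual conformal factor \<open>r\<^sup>2 / |x - a|\<^sup>2\<close> of the inversion.
  The two remaining values are forced: the transformation law of the separation of \<open>a\<close> or
  \<open>\<infinity>\<close> from a third point leaves no choice. In coordinates centred at \<open>a\<close>, inversion
  swaps the leading and the constant coefficient of a quadric, up to powers of \<open>r\<close> that cancel in
  their product; this is why the discriminant survives.\<close>

lemma sphere_reflection_conformal_factor:
  assumes r: "r > 0"
  shows "conformal_factor (sphere_reflection a r)
    (\<lambda>z. case z of None \<Rightarrow> r\<^sup>2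
       | Some x \<Rightarrow> if x = a then 1 / r\<^sup>2 else r\<^sup>2 / ((x - a) \<bullet> (x - a)))"
    (is "conformal_factor _ ?l")
  unfolding conformal_factor_def
proof (intro conjI allI)
  show "?l z > 0" for z
    using r by (auto split: option.splits)
  have inv: "(c / (u \<bullet> u)) *\<^sub>R u \<bullet> (c / (u \<bullet> u)) *\<^sub>R u = c * c / (u \<bullet> u)"
    for u :: 'a and c :: real
    by (cases "u = 0") (simp_all add: field_simps)
  have inv2: "((c / (u \<bullet> u)) *\<^sub>R u - (c / (v \<bullet> v)) *\<^sub>R v) \<bullet> ((c / (u \<bullet> u)) *\<^sub>R u - (c / (v \<bullet> v)) *\<^sub>R v)
      = c / (u \<bullet> u) * (c / (v \<bullet> v)) * ((u - v) \<bullet> (u - v))"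
    if "u \<noteq> 0" "v \<noteq> 0" for u v :: 'a and c :: real
  proof -
    have "u \<bullet> u \<noteq> 0" "v \<bullet> v \<noteq> 0" using that by auto
    then show ?thesis
      by (simp add: inner_diff_left inner_diff_right inner_commute[of v u] field_simps)
  qed
  show "separation (sphere_reflection a r z) (sphere_reflection a r w)
      = ?l z * ?l w * separation z w" for z w
  proof (cases z; cases w)
    fix x y assume "z = Some x" "w = Some y"
    then show ?thesis
      using r inv2[of "x - a" "y - a" "r\<^sup>2"]
      by (auto simp: separation_def sphere_reflection_def power2_norm_eq_inner
          inner_diff_swap[of a])
  next
    fix x assume "z = Some x" "w = None"
    then show ?thesis
      using r inv[of "r\<^sup>2" "x - a"]
      by (auto simp: separation_def sphere_reflection_def power2_norm_eq_inner)
  next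
    fix x assume "z = None" "w = Some x"
    then show ?thesis
      using r inv[of "r\<^sup>2" "x - a"]
      by (auto simp: separation_def sphere_reflection_def power2_norm_eq_inner)
  next
    assume "z = None" "w = None"
    then show ?thesis
      by (simp add: separation_def sphere_reflection_def)
  qed
  fix \<alpha> \<gamma> :: real and b :: 'a
  \<comment> \<open>\<open>b\<^sub>0\<close> and \<open>q\<close> are the linear and constant coefficients at the centre \<open>a\<close>; the primed values are
    the swapped coefficients moved back to the origin.\<close>
  define q where "q = \<alpha> * (a \<bullet> a) + b \<bullet> a + \<gamma>"
  define b\<^sub>0 where "b\<^sub>0 = b + (2 * \<alpha>) *\<^sub>R a"
  define \<alpha>' where "\<alpha>' = q / r\<^sup>2"
  define b' where "b' = b\<^sub>0 - (2 * \<alpha>') *\<^sub>R a"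
  define \<gamma>' where "\<gamma>' = \<alpha> * r\<^sup>2 - b\<^sub>0 \<bullet> a + \<alpha>' * (a \<bullet> a)"
  have centred: "\<alpha> * ((a + u) \<bullet> (a + u)) + b \<bullet> (a + u) + \<gamma> = \<alpha> * (u \<bullet> u) + b\<^sub>0 \<bullet> u + q" for u
    by (simp add: q_def b\<^sub>0_def inner_simps inner_commute algebra_simps)
  have centred': "\<alpha>' * ((a + u) \<bullet> (a + u)) + b' \<bullet> (a + u) + \<gamma>'
      = \<alpha>' * (u \<bullet> u) + b\<^sub>0 \<bullet> u + \<alpha> * r\<^sup>2" for u
    by (simp add: b'_def \<gamma>'_def inner_simps inner_commute algebra_simps)
  have q: "q = \<alpha>' * r\<^sup>2"
    using r by (simp add: \<alpha>'_def)
  have "discriminant \<alpha>' b' \<gamma>' = b\<^sub>0 \<bullet> b\<^sub>0 - 4 * \<alpha> * q"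
    by (simp add: q b'_def \<gamma>'_def discriminant_def inner_simps inner_commute algebra_simps)
  also have "\<dots> = discriminant \<alpha> b \<gamma>"
    by (simp add: q_def b\<^sub>0_def discriminant_def inner_simps inner_commute algebra_simps)
  finally have disc: "discriminant \<alpha>' b' \<gamma>' = discriminant \<alpha> b \<gamma>" .
  have "quadric \<alpha> b \<gamma> (sphere_reflection a r z) = ?l z * quadric \<alpha>' b' \<gamma>' z" for z
  proof (cases z)
    case None
    then show ?thesis
      using q by (simp add: quadric_def sphere_reflection_def q_def)
  next
    case (Some x)
    define u where "u = x - a"
    have x: "x = a + u" by (simp add: u_def)
    show ?thesis
    proof (cases "u = 0")
      case True
      then show ?thesis
        using Some r centred'[of 0] by (simp add: quadric_def sphere_reflection_def x)
    next
      case False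
      have "quadric \<alpha> b \<gamma> (sphere_reflection a r z)
          = \<alpha> * (r\<^sup>2 * r\<^sup>2 / (u \<bullet> u)) + r\<^sup>2 / (u \<bullet> u) * (b\<^sub>0 \<bullet> u) + q"
        using Some False inv[of "r\<^sup>2" u] centred[of "(r\<^sup>2 / (u \<bullet> u)) *\<^sub>R u"]
        by (simp add: quadric_def sphere_reflection_def x power2_norm_eq_inner)
      also have "\<dots> = r\<^sup>2 / (u \<bullet> u) * (\<alpha>' * (u \<bullet> u) + b\<^sub>0 \<bullet> u + \<alpha> * r\<^sup>2)"
        using False by (simp add: q field_simps)
      also have "\<dots> = ?l z * quadric \<alpha>' b' \<gamma>' z"
        using Some False centred'[of u] by (simp add: quadric_def x)
      finally show ?thesis .
    qed
  qed
  with disc show "\<exists>\<alpha>' b' \<gamma>'. discriminant \<alpha>' b' \<gamma>' = discriminant \<alpha> b \<gamma> \<and>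
      (\<forall>z. quadric \<alpha> b \<gamma> (sphere_reflection a r z) = ?l z * quadric \<alpha>' b' \<gamma>' z)"
    by blast
qed

text \<open>A hyperplane reflection is a Euclidean isometry, so its conformal factor is 1. It is treated
  as its linear part \<open>R\<close>, a self-adjoint involution, followed by the translation by \<open>c\<close>.\<close>

lemma hyperplane_reflection_conformal_factor:
  assumes v: "v \<noteq> 0"
  shows "conformal_factor (hyperplane_reflection v t) (\<lambda>_. 1)"
  unfolding conformal_factor_def
proof (intro conjI allI)
  define n where "n = v \<bullet> v"
  have n: "n \<noteq> 0" using v by (simp add: n_def)
  define R where "R u = u - (2 * (v \<bullet> u) / n) *\<^sub>R v" for u
  define c where "c = (2 * t / n) *\<^sub>R v"
  have R_adj: "R u \<bullet> w = u \<bullet> R w" for u w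
    by (simp add: R_def inner_simps inner_commute)
  have R_invol: "R (R u) = u" for u
    using n by (simp add: R_def inner_simps n_def[symmetric] field_simps)
  have R_isom: "R u \<bullet> R w = u \<bullet> w" for u w
    by (simp add: R_adj R_invol)
  have R_diff: "R u - R w = R (u - w)" for u w
    by (simp add: R_def inner_simps algebra_simps diff_divide_distrib)
  have refl: "hyperplane_reflection v t z = (case z of None \<Rightarrow> None | Some x \<Rightarrow> Some (R x + c))" for z
    by (auto simp: hyperplane_reflection_def R_def c_def power2_norm_eq_inner n_def[symmetric]
        algebra_simps diff_divide_distrib split: option.splits)
  show "separation (hyperplane_reflection v t z) (hyperplane_reflection v t w)
      = 1 * 1 * separation z w" for z w
    by (auto simp: separation_def refl R_diff R_isom split: option.splits)
  show "(1::real) > 0" by simp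
  fix \<alpha> \<gamma> :: real and b :: 'a
  define b' where "b' = R (b + (2 * \<alpha>) *\<^sub>R c)"
  define \<gamma>' where "\<gamma>' = \<alpha> * (c \<bullet> c) + b \<bullet> c + \<gamma>"
  have "discriminant \<alpha> b' \<gamma>' = discriminant \<alpha> b \<gamma>"
    by (simp add: b'_def R_isom \<gamma>'_def discriminant_def inner_simps inner_commute algebra_simps)
  moreover have "quadric \<alpha> b \<gamma> (hyperplane_reflection v t z) = 1 * quadric \<alpha> b' \<gamma>' z" for z
    by (auto simp: quadric_def refl b'_def \<gamma>'_def R_adj R_invol inner_add_left inner_add_right
        inner_commute[of c "R _"] algebra_simps split: option.splits)
  ultimately show "\<exists>\<alpha>' b' \<gamma>'. discriminant \<alpha>' b' \<gamma>' = discriminant \<alpha> b \<gamma> \<and>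
      (\<forall>z. quadric \<alpha> b \<gamma> (hyperplane_reflection v t z) = 1 * quadric \<alpha>' b' \<gamma>' z)"
    by blast
qed

lemma moebius_conformal_factor:
  assumes "moebius_transformation f"
  shows "\<exists>l. conformal_factor f l"
  using assms
proof induction
  case sphere
  then show ?case using sphere_reflection_conformal_factor by (intro exI)
next
  case hyperplane
  then show ?case using hyperplane_reflection_conformal_factor by (intro exI)
next
  case comp
  then show ?case using conformal_factor_comp by fast
qed

section \<open>The hyperbolic invariant of the half-space and the ball\<close>

text \<open>By continuity the quadric vanishes on the whole boundary hyperplane. The points \<open>0\<close> and
  \<open>\<plusminus>e\<^sub>j\<close> with \<open>j \<noteq> k\<close> lie there and kill every coefficient but \<open>b $ k\<close>; such a \<open>j\<close> exists because
  the dimension is at least 2. The discriminant then fixes the remaining scale.\<close>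

lemma quadric_positive_on_half_space:
  fixes k :: "'n::finite" and b :: "real ^ 'n"
  assumes n: "CARD('n) \<ge> 2"
    and disc: "discriminant \<alpha> b \<gamma> = 4"
    and pos: "\<And>x. quadric \<alpha> b \<gamma> (Some x) > 0 \<longleftrightarrow> x $ k > 0"
  shows "quadric \<alpha> b \<gamma> (Some x) = 2 * x $ k"
proof -
  have zero: "\<alpha> * (p \<bullet> p) + b \<bullet> p + \<gamma> = 0" if p: "p $ k = 0" for p
  proof (rule antisym)
    show "\<alpha> * (p \<bullet> p) + b \<bullet> p + \<gamma> \<le> 0"
      using pos[of p] p by (simp add: quadric_def)
    let ?h = "\<lambda>e. \<alpha> * ((p + e *\<^sub>R axis k 1) \<bullet> (p + e *\<^sub>R axis k 1)) + b \<bullet> (p + e *\<^sub>R axis k 1) + \<gamma>"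
    have "(?h \<longlongrightarrow> ?h 0) (at_right 0)"
      by (intro tendsto_intros)
    moreover have "?h e \<ge> 0" if "e > 0" for e
      using pos[of "p + e *\<^sub>R axis k 1"] that p by (simp add: quadric_def less_imp_le)
    then have "eventually (\<lambda>e. ?h e \<ge> 0) (at_right 0)"
      by (simp add: eventually_at_right_less eventually_at_filter)
    ultimately have "0 \<le> ?h 0"
      by (intro tendsto_lowerbound) auto
    then show "0 \<le> \<alpha> * (p \<bullet> p) + b \<bullet> p + \<gamma>" by simp
  qed
  have \<gamma>: "\<gamma> = 0"
    using zero[of 0] by simp
  have axes: "\<alpha> = 0 \<and> b $ j = 0" if "j \<noteq> k" for j
  proof -
    have "(axis j 1 :: real ^ 'n) $ k = 0"
      using that by (simp add: axis_def)
    then have "\<alpha> + b $ j = 0" "\<alpha> - b $ j = 0"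
      using zero[of "axis j 1"] zero[of "- axis j 1"] \<gamma> by (simp_all add: inner_axis)
    then show ?thesis by simp
  qed
  obtain j where "j \<noteq> k"
  proof -
    have "\<exists>j. j \<noteq> k"
    proof (rule ccontr)
      assume "\<not> (\<exists>j. j \<noteq> k)"
      then have "(UNIV :: 'n set) = {k}" by auto
      then have "CARD('n) = 1" by (metis card.empty card.insert empty_iff finite.emptyI One_nat_def)
      with n show False by simp
    qed
    then show thesis using that by blast
  qed
  then have \<alpha>: "\<alpha> = 0" using axes by blast
  have b: "b = b $ k *\<^sub>R axis k 1"
    using axes by (auto simp: vec_eq_iff axis_def)
  have inner_b: "b \<bullet> y = b $ k * y $ k" for y
    by (subst b) (simp add: inner_axis' )
  have "(b $ k)\<^sup>2 = 2\<^sup>2"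
    using disc inner_b[of b] by (simp add: discriminant_def \<alpha> power2_eq_square)
  moreover have "b $ k > 0"
    using pos[of "axis k 1"] by (simp add: quadric_def \<alpha> \<gamma> inner_b)
  ultimately have "b $ k = 2"
    by (auto simp only: power2_eq_iff)
  then show ?thesis
    by (simp add: quadric_def \<alpha> \<gamma> inner_b)
qed

text \<open>This is the invariance of \<open>sinh\<^sup>2 (\<rho> / 2)\<close>, cleared of denominators. Both \<open>1 - |x|\<^sup>2\<close> and
  \<open>2 x\<^sub>k\<close> have discriminant 4, so one pulls back to the other exactly and not just up to a constant.\<close>

lemma half_space_to_ball_invariant:
  fixes k :: "'n::finite"
  assumes n: "CARD('n) \<ge> 2" and f: "moebius_half_space_to_ball k f"
    and x: "x \<in> upper_half_space k" and y: "y \<in> upper_half_space k"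
    and x': "f (Some x) = Some x'" and y': "f (Some y) = Some y'"
  shows "(norm (x' - y'))\<^sup>2 * (4 * x $ k * y $ k)
    = (norm (x - y))\<^sup>2 * ((1 - (norm x')\<^sup>2) * (1 - (norm y')\<^sup>2))"
proof -
  obtain l where l: "conformal_factor f l"
    using f moebius_conformal_factor[of f] by (auto simp: moebius_half_space_to_ball_def)
  obtain \<alpha> b \<gamma> where disc: "discriminant \<alpha> b \<gamma> = discriminant (-1) (0 :: real ^ 'n) 1"
    and pull: "\<And>z. quadric (-1) 0 1 (f z) = l z * quadric \<alpha> b \<gamma> z"
    using l unfolding conformal_factor_def by metis
  have lpos: "l z > 0" for z
    using l by (simp add: conformal_factor_def)
  have ball: "quadric (-1) 0 1 w > 0 \<longleftrightarrow> w \<in> Some ` ball 0 1" for w :: "(real ^ 'n) option"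
    by (auto simp: quadric_def dot_square_norm abs_square_less_1 split: option.splits)
  have "quadric \<alpha> b \<gamma> (Some p) > 0 \<longleftrightarrow> p $ k > 0" for p
  proof -
    have "quadric \<alpha> b \<gamma> (Some p) > 0 \<longleftrightarrow> f (Some p) \<in> Some ` ball 0 1"
      using pull[of "Some p"] lpos[of "Some p"] by (simp add: ball[symmetric] zero_less_mult_iff)
    also have "\<dots> \<longleftrightarrow> f (Some p) \<in> f ` Some ` upper_half_space k"
      using f by (simp add: moebius_half_space_to_ball_def)
    also have "\<dots> \<longleftrightarrow> p $ k > 0"
      using conformal_factor_inj[OF l] by (auto simp: inj_image_mem_iff upper_half_space_def)
    finally show ?thesis .
  qed
  then have "quadric \<alpha> b \<gamma> (Some p) = 2 * p $ k" for p
    using quadric_positive_on_half_space[OF n, of \<alpha> b \<gamma>] disc by (simp add: discriminant_def)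
  then have ball_eq: "1 - (norm x')\<^sup>2 = l (Some x) * (2 * x $ k)"
      "1 - (norm y')\<^sup>2 = l (Some y) * (2 * y $ k)"
    using pull[of "Some x"] pull[of "Some y"] x' y'
    by (simp_all add: quadric_def dot_square_norm)
  have "separation (f (Some x)) (f (Some y)) = l (Some x) * l (Some y) * separation (Some x) (Some y)"
    using l by (simp add: conformal_factor_def)
  then have "(norm (x' - y'))\<^sup>2 = l (Some x) * l (Some y) * (norm (x - y))\<^sup>2"
    by (simp add: x' y' separation_def dot_square_norm)
  with ball_eq show ?thesis by simp
qed

section \<open>Comparing the Gromov metric with the hyperbolic invariant\<close>

lemma infdist_eqI:
  assumes "a \<in> A" "dist x a = m" "\<And>b. b \<in> A \<Longrightarrow> m \<le> dist x b"
  shows "infdist x A = m"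
proof (rule antisym)
  show "infdist x A \<le> m" using assms infdist_le by metis
  show "m \<le> infdist x A"
    using assms by (auto simp: infdist_def intro!: cINF_greatest)
qed

lemma boundary_dist_upper_half_space:
  fixes k :: "'n::finite"
  assumes "x \<in> upper_half_space k"
  shows "boundary_dist (upper_half_space k) x = x $ k"
  unfolding boundary_dist_def
proof (rule infdist_eqI)
  have "upper_half_space k = {x. axis k 1 \<bullet> x > 0}"
    by (simp add: upper_half_space_def inner_axis')
  then have fr: "frontier (upper_half_space k) = {x. x $ k = 0}"
    using frontier_halfspace_gt[of "axis k (1::real)" 0] by (simp add: inner_axis')
  show "x - x $ k *\<^sub>R axis k 1 \<in> frontier (upper_half_space k)"
    by (simp add: fr)
  show "dist x (x - x $ k *\<^sub>R axis k 1) = x $ k"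
    using assms by (simp add: dist_norm upper_half_space_def)
  show "x $ k \<le> dist x b" if "b \<in> frontier (upper_half_space k)" for b
    using component_le_norm_cart[of "x - b" k] that by (simp add: fr dist_norm)
qed

lemma boundary_dist_unit_ball:
  fixes x :: "'a::euclidean_space"
  assumes "x \<in> ball 0 1"
  shows "boundary_dist (ball 0 1) x = 1 - norm x"
  unfolding boundary_dist_def
proof -
  obtain i :: 'a where i: "i \<in> Basis" using nonempty_Basis by blast
  \<comment> \<open>The boundary point nearest to \<open>x\<close>; from the centre every direction serves equally well.\<close>
  define e where "e = (if x = 0 then i else x /\<^sub>R norm x)"
  have e: "norm e = 1" "x = norm x *\<^sub>R e"
    using i by (auto simp: e_def)
  show "infdist x (frontier (ball 0 1)) = 1 - norm x"
  proof (rule infdist_eqI)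
    show "e \<in> frontier (ball 0 1)" using e by simp
    have "x - e = (norm x - 1) *\<^sub>R e"
      using e(2) by (simp add: algebra_simps)
    then show "dist x e = 1 - norm x"
      using e(1) assms by (simp add: dist_norm)
    show "1 - norm x \<le> dist x b" if "b \<in> frontier (ball 0 1)" for b
      using that norm_triangle_ineq2[of b x] by (simp add: dist_norm norm_minus_commute)
  qed
qed

text \<open>The hypothesis says \<open>q - 1/q \<le> \<sigma>\<close>, so the exact bound is the root
  \<open>\<sigma>/2 + sqrt (1 + \<sigma>\<^sup>2/4)\<close>; the stated polynomial majorant comes from
  \<open>sqrt (1 + v) \<le> 1 + v/2\<close> and is good enough for a cubic bound on the Gromov quotient.\<close>

lemma sqrt_ratio_bound:
  fixes \<sigma> q :: real
  assumes q: "q > 0" and \<sigma>: "\<sigma> \<ge> 0" and le: "q\<^sup>2 - 1 \<le> \<sigma> * q"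
  shows "q \<le> 1 + \<sigma> / 2 + \<sigma>\<^sup>2 / 8"
proof (rule ccontr)
  define Q where "Q = 1 + \<sigma> / 2 + \<sigma>\<^sup>2 / 8"
  assume "\<not> ?thesis"
  then have gt: "q > Q" by (simp add: Q_def)
  have "Q * (Q - \<sigma>) = 1 + \<sigma> ^ 4 / 64"
    by (simp add: Q_def field_simps power2_eq_square power4_eq_xxxx)
  then have 1: "Q * (Q - \<sigma>) \<ge> 1" by simp
  have Q: "Q \<ge> 1" using \<sigma> by (simp add: Q_def)
  have "Q - \<sigma> > 0"
    using 1 Q by (smt (verit) mult_nonneg_nonpos)
  then have "Q * (Q - \<sigma>) < q * (q - \<sigma>)"
    using gt Q by (intro mult_strict_mono) auto
  moreover have "q * (q - \<sigma>) \<le> 1"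
    using le by (simp add: algebra_simps power2_eq_square)
  ultimately show False using 1 by simp
qed

text \<open>The quotient splits as \<open>s/m + q\<close> with \<open>m = sqrt (c d)\<close> and
  \<open>q = max c d / m = sqrt (max c d / min c d)\<close>. The lower bound uses \<open>s/m \<ge> T\<close> and \<open>q \<ge> 1\<close>. For
  the upper bound, \<open>\<bar>c - d\<bar> \<le> s\<close> reads \<open>q - 1/q \<le> s/m \<le> 2T\<close>, whence
  \<open>s/m + q \<le> 1 + 3T + T\<^sup>2/2\<close>, and this is below \<open>(1 + T)\<^sup>3\<close>.\<close>

lemma gromov_ratio_bounds:
  fixes c d s T :: real
  assumes "c > 0" "d > 0" and T: "T \<ge> 0" and cd: "\<bar>c - d\<bar> \<le> s"
    and lo: "T * sqrt (c * d) \<le> s" and hi: "s \<le> 2 * T * sqrt (c * d)"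
  shows "1 + T \<le> (s + max c d) / sqrt (c * d)"
    and "(s + max c d) / sqrt (c * d) \<le> (1 + T) ^ 3"
proof -
  define m where "m = sqrt (c * d)"
  define M where "M = max c d"
  define q where "q = M / m"
  have m: "m > 0" "m * m = c * d" using assms by (simp_all add: m_def)
  have M: "M > 0" "M * M - c * d \<le> s * M"
  proof -
    show "M > 0" using assms by (simp add: M_def)
    have "M * (M - s) \<le> M * min c d"
      using \<open>M > 0\<close> cd by (intro mult_left_mono) (auto simp: M_def)
    moreover have "M * min c d = c * d" by (auto simp: M_def min_def max_def)
    ultimately show "M * M - c * d \<le> s * M" by (simp add: algebra_simps)
  qed
  have q: "q > 0" using M m by (simp add: q_def)
  have E: "(s + max c d) / sqrt (c * d) = s / m + q"
    by (simp add: m_def M_def q_def add_divide_distrib)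
  have sm: "T \<le> s / m" "s / m \<le> 2 * T"
    using lo hi m by (simp_all add: m_def[symmetric] field_simps)
  have "m\<^sup>2 \<le> M\<^sup>2"
    using assms m unfolding power2_eq_square M_def by (auto intro!: mult_mono)
  then have "m \<le> M" using M by (simp add: power2_le_iff_abs_le)
  then have "q \<ge> 1" using m by (simp add: q_def)
  with sm E show "1 + T \<le> (s + max c d) / sqrt (c * d)" by simp
  have "q\<^sup>2 - 1 = (M * M - c * d) / (m * m)"
    using m(1) by (simp add: q_def power2_eq_square diff_divide_distrib flip: m(2))
  also have "\<dots> \<le> s * M / (m * m)"
    using M by (intro divide_right_mono) auto
  also have "\<dots> \<le> 2 * T * q"
    using mult_right_mono[OF sm(2), of q] q by (simp add: q_def)
  finally have "q \<le> 1 + (2 * T) / 2 + (2 * T)\<^sup>2 / 8"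
    using q T by (intro sqrt_ratio_bound) auto
  then have "s / m + q \<le> 1 + 3 * T + T\<^sup>2 / 2"
    using sm by (simp add: power2_eq_square)
  also have "\<dots> \<le> (1 + T) ^ 3"
    using T by (simp add: power3_eq_cube power2_eq_square algebra_simps)
  finally show "(s + max c d) / sqrt (c * d) \<le> (1 + T) ^ 3" using E by simp
qed

text \<open>The factor 2 between the lower and the upper hypothesis is what makes the lemma apply to both
  domains: the half-space attains the upper hypothesis with equality, while in the ball the distance
  lies in between, approaching the lower end for points near the centre and the upper end for points
  near the boundary.\<close>

lemma gromov_metric_bounds:
  assumes dx: "boundary_dist D x > 0" and dy: "boundary_dist D y > 0" and T: "T \<ge> 0"
    and lo: "T * sqrt (boundary_dist D x * boundary_dist D y) \<le> norm (x - y)"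
    and hi: "norm (x - y) \<le> 2 * T * sqrt (boundary_dist D x * boundary_dist D y)"
  shows "2 * ln (1 + T) \<le> gromov_metric D x y" and "gromov_metric D x y \<le> 6 * ln (1 + T)"
proof -
  have "\<bar>boundary_dist D x - boundary_dist D y\<bar> \<le> norm (x - y)"
    using infdist_triangle_abs[of x "frontier D" y] by (simp add: boundary_dist_def dist_norm)
  note b = gromov_ratio_bounds[OF dx dy T this lo hi]
  show "2 * ln (1 + T) \<le> gromov_metric D x y"
    using b(1) T by (simp add: gromov_metric_def)
  have "gromov_metric D x y \<le> 2 * ln ((1 + T) ^ 3)"
    unfolding gromov_metric_def using b T by (intro mult_left_mono ln_mono) auto
  also have "\<dots> = 6 * ln (1 + T)"
    using T by (simp add: ln_realpow)
  finally show "gromov_metric D x y \<le> 6 * ln (1 + T)" .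
qed

lemma half_space_to_ball_bounds:
  fixes k :: "'n::finite"
  assumes n: "CARD('n) \<ge> 2" and f: "moebius_half_space_to_ball k f"
    and x: "x \<in> upper_half_space k" and y: "y \<in> upper_half_space k"
  defines "uH \<equiv> gromov_metric (upper_half_space k) x y"
    and "uB \<equiv> gromov_metric (ball 0 1) (the (f (Some x))) (the (f (Some y)))"
  shows "1/3 * uH \<le> uB" and "uB \<le> 3 * uH"
proof -
  have img: "f (Some p) \<in> Some ` ball 0 1" if "p \<in> upper_half_space k" for p
    using f that unfolding moebius_half_space_to_ball_def by blast
  obtain x' where x': "f (Some x) = Some x'" "x' \<in> ball 0 1" using img[OF x] by auto
  obtain y' where y': "f (Some y) = Some y'" "y' \<in> ball 0 1" using img[OF y] by auto
  have pos: "x $ k > 0" "y $ k > 0" using x y by (auto simp: upper_half_space_def)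
  define T where "T = norm (x - y) / (2 * sqrt (x $ k * y $ k))"
  have T: "T \<ge> 0" using pos by (simp add: T_def)
  have sH: "norm (x - y) = 2 * T * sqrt (x $ k * y $ k)" using pos by (simp add: T_def)
  have H: "2 * ln (1 + T) \<le> uH" "uH \<le> 6 * ln (1 + T)"
    unfolding uH_def using sH pos T
    by (auto intro!: gromov_metric_bounds simp: boundary_dist_upper_half_space x y)
  define a where "a = 1 - norm x'"
  define b where "b = 1 - norm y'"
  have ab: "0 < a" "a \<le> 1" "0 < b" "b \<le> 1"
    using x' y' by (simp_all add: a_def b_def)
  have fac: "1 - (norm x')\<^sup>2 = a * (2 - a)" "1 - (norm y')\<^sup>2 = b * (2 - b)"
    by (simp_all add: a_def b_def power2_eq_square algebra_simps)
  have "(norm (x' - y'))\<^sup>2 * (4 * x $ k * y $ k)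
      = (T\<^sup>2 * ((a * b) * ((2 - a) * (2 - b)))) * (4 * x $ k * y $ k)"
    using half_space_to_ball_invariant[OF n f x y x'(1) y'(1)] pos
    by (simp add: fac sH power_mult_distrib)
  then have sq: "(norm (x' - y'))\<^sup>2 = T\<^sup>2 * ((a * b) * ((2 - a) * (2 - b)))"
    using pos by simp
  have P: "1 \<le> (2 - a) * (2 - b)" "(2 - a) * (2 - b) \<le> 4"
    using ab mult_mono[of 1 "2 - a" 1 "2 - b"] mult_mono[of "2 - a" 2 "2 - b" 2] by auto
  have sB: "norm (x' - y') = T * sqrt (a * b) * sqrt ((2 - a) * (2 - b))"
    using sq T by (metis norm_ge_zero real_sqrt_mult real_sqrt_unique mult.assoc abs_of_nonneg
        real_sqrt_abs)
  have root: "1 \<le> sqrt ((2 - a) * (2 - b))" "sqrt ((2 - a) * (2 - b)) \<le> 2"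
    using P by (auto intro: real_le_lsqrt)
  have t: "0 \<le> T * sqrt (a * b)" using T ab by simp
  have "T * sqrt (a * b) \<le> norm (x' - y')" "norm (x' - y') \<le> 2 * T * sqrt (a * b)"
    using mult_left_mono[OF root(1) t] mult_left_mono[OF root(2) t] by (simp_all add: sB)
  then have B: "2 * ln (1 + T) \<le> uB" "uB \<le> 6 * ln (1 + T)"
    unfolding uB_def using ab T x' y'
    by (auto intro!: gromov_metric_bounds simp: boundary_dist_unit_ball a_def b_def)
  show "1/3 * uH \<le> uB" "uB \<le> 3 * uH"
    using H B by linarith+
qed

section \<open>Sharpness of the lower bound\<close>

text \<open>The sphere of radius \<open>sqrt 2\<close> about \<open>-e\<^sub>k\<close> meets the boundary hyperplane exactly in the unit
  sphere of that hyperplane, so its reflection \<open>s\<close> interchanges the hyperplane and the unit sphere.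
  Quantitatively, \<open>|s x|\<^sup>2 = 1 - 4 x\<^sub>k / |x + e\<^sub>k|\<^sup>2\<close>; the image is the whole ball because \<open>s\<close> is an
  involution.\<close>

lemma sphere_reflection_half_space_to_ball:
  fixes k :: "'n::finite"
  shows "moebius_half_space_to_ball k (sphere_reflection (- axis k 1) (sqrt 2))"
proof -
  let ?e = "axis k 1 :: real ^ 'n"
  define s where "s x = (2 / ((x + ?e) \<bullet> (x + ?e))) *\<^sub>R (x + ?e) - ?e" for x
  have s: "sphere_reflection (- ?e) (sqrt 2) (Some x) = Some (s x)" if "x \<noteq> - ?e" for x
    using that by (simp add: sphere_reflection_def s_def power2_norm_eq_inner)
  have shift: "u \<bullet> u + 1 - 2 * u $ k = (u - ?e) \<bullet> (u - ?e)" for u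
    by (simp add: inner_diff_left inner_diff_right inner_axis inner_axis')
  have ball: "s x \<bullet> s x = 1 - 4 * x $ k / ((x + ?e) \<bullet> (x + ?e))" if "x \<noteq> - ?e" for x
  proof -
    define u where "u = x + ?e"
    have u: "u \<bullet> u \<noteq> 0" and x: "x = u - ?e" using that by (auto simp: u_def eq_neg_iff_add_eq_0)
    have "s x \<bullet> s x = 1 - 4 * (u $ k - 1) / (u \<bullet> u)"
      using u shift[of "(2 / (u \<bullet> u)) *\<^sub>R u"] 
      by (simp add: s_def u_def[symmetric] shift[symmetric] field_simps)
    then show ?thesis by (simp add: u_def)
  qed
  have invol: "s (s x) = x" if "x \<noteq> - ?e" for x
  proof -
    define u where "u = x + ?e"
    have u: "u \<bullet> u \<noteq> 0" and x: "x = u - ?e" using that by (auto simp: u_def eq_neg_iff_add_eq_0)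
    have "s x + ?e = (2 / (u \<bullet> u)) *\<^sub>R u" by (simp add: s_def u_def)
    then have "s (s x) = (2 / (4 / (u \<bullet> u))) *\<^sub>R (2 / (u \<bullet> u)) *\<^sub>R u - ?e"
      using u by (simp add: s_def[of "s x"])
    then show ?thesis using u by (simp add: x)
  qed
  have avoid: "s x \<noteq> - ?e" if "x \<noteq> - ?e" for x
    using that by (simp add: s_def eq_neg_iff_add_eq_0)
  have iff: "s x \<in> ball 0 1 \<longleftrightarrow> x \<in> upper_half_space k" if "x \<noteq> - ?e" for x
  proof -
    have "(x + ?e) \<bullet> (x + ?e) > 0" using that by (simp add: eq_neg_iff_add_eq_0)
    then have "s x \<bullet> s x < 1 \<longleftrightarrow> x $ k > 0"
      by (simp add: ball[OF that] zero_less_divide_iff)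
        (use inner_ge_zero[of "x + ?e"] in linarith)
    then show ?thesis
      by (simp add: upper_half_space_def dot_square_norm abs_square_less_1)
  qed
  have neH: "x \<noteq> - ?e" if "x \<in> upper_half_space k" for x
    using that by (auto simp: upper_half_space_def)
  have neB: "x \<noteq> - ?e" if "x \<in> ball 0 1" for x
    using that by auto
  have "s ` upper_half_space k = ball 0 1"
  proof
    show "s ` upper_half_space k \<subseteq> ball 0 1"
      using iff neH by blast
    show "ball 0 1 \<subseteq> s ` upper_half_space k"
    proof
      fix z :: "real ^ 'n" assume z: "z \<in> ball 0 1"
      then have "s z \<in> upper_half_space k"
        using iff[OF avoid[OF neB[OF z]]] invol[OF neB[OF z]] by simp
      then show "z \<in> s ` upper_half_space k"
        using invol[OF neB[OF z]] by (metis image_eqI)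
    qed
  qed
  moreover have "sphere_reflection (- ?e) (sqrt 2) ` Some ` upper_half_space k
      = Some ` s ` upper_half_space k"
    unfolding image_image by (rule image_cong[OF refl]) (rule s[OF neH])
  ultimately show ?thesis
    by (simp add: moebius_half_space_to_ball_def moebius_transformation.sphere)
qed

text \<open>Both estimates behind the factor 3 are attained to first order here: on a vertical line the
  heights differ by the full distance of the points, the worst case in the half-space, while the
  image points have equal boundary distances close to 1, the best case in the ball.\<close>

lemma gromov_metric_extremal_pair:
  fixes k :: "'n::finite" and t :: real
  assumes t: "t > 1"
  defines "f \<equiv> sphere_reflection (- axis k 1 :: real ^ 'n) (sqrt 2)"
    and "x \<equiv> t *\<^sub>R axis k 1" and "y \<equiv> (1 / t) *\<^sub>R axis k 1"
  shows "gromov_metric (upper_half_space k) x y = 2 * ln (2 * t - 1 / t)"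
    and "gromov_metric (ball 0 1) (the (f (Some x))) (the (f (Some y))) = 2 * ln t"
proof -
  let ?e = "axis k 1 :: real ^ 'n"
  have t1: "1 / t < t" using t by (simp add: field_simps) (smt (verit) mult_less_cancel_right1)
  have H: "x \<in> upper_half_space k" "y \<in> upper_half_space k"
    using t by (simp_all add: x_def y_def upper_half_space_def)
  have "x - y = (t - 1 / t) *\<^sub>R ?e" by (simp add: x_def y_def algebra_simps)
  then have "norm (x - y) = t - 1 / t" using t1 by simp
  then show "gromov_metric (upper_half_space k) x y = 2 * ln (2 * t - 1 / t)"
    using t t1 by (simp add: gromov_metric_def boundary_dist_upper_half_space H)
      (simp add: x_def y_def max_def)
  define r where "r = (t - 1) / (t + 1)"
  have r: "0 < r" "r < 1" using t by (simp_all add: r_def)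
  have f_axis: "f (Some (c *\<^sub>R ?e)) = Some (((1 - c) / (1 + c)) *\<^sub>R ?e)" if c: "c > 0" for c
  proof -
    have ne: "c *\<^sub>R ?e \<noteq> - ?e"
    proof
      assume "c *\<^sub>R ?e = - ?e"
      then have "(c *\<^sub>R ?e) $ k = (- ?e) $ k" by simp
      with c show False by simp
    qed
    have sum: "c *\<^sub>R ?e + ?e = (c + 1) *\<^sub>R ?e" by (simp add: algebra_simps)
    have "- ?e + (2 / (c + 1)\<^sup>2) *\<^sub>R (c + 1) *\<^sub>R ?e = (2 / (c + 1)\<^sup>2 * (c + 1) - 1) *\<^sub>R ?e"
      by (simp add: scaleR_diff_left)
    also have "2 / (c + 1)\<^sup>2 * (c + 1) - 1 = (1 - c) / (1 + c)"
    proof -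
      have "2 / n\<^sup>2 * n = 2 / n" for n :: real
        by (simp add: power2_eq_square)
      from this[of "c + 1"] show ?thesis using c by (simp add: field_simps)
    qed
    finally show ?thesis
      using ne c by (simp add: f_def sphere_reflection_def sum)
  qed
  have "(1 - t) / (1 + t) = - r"
    by (simp add: r_def minus_divide_left add.commute)
  moreover have "1 - 1 / t = (t - 1) / t" "1 + 1 / t = (t + 1) / t"
    using t by (simp_all add: field_simps)
  then have "(1 - 1 / t) / (1 + 1 / t) = r"
    using t by (simp only: r_def) simp
  ultimately have fx: "the (f (Some x)) = (- r) *\<^sub>R ?e" and fy: "the (f (Some y)) = r *\<^sub>R ?e"
    using t f_axis[of t] f_axis[of "1 / t"] by (simp_all add: x_def y_def)
  have "(- r) *\<^sub>R ?e - r *\<^sub>R ?e = (- 2 * r) *\<^sub>R ?e"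
    by (simp only: scaleR_diff_left[symmetric]) simp
  then have "norm ((- r) *\<^sub>R ?e - r *\<^sub>R ?e) = 2 * r" using r by simp
  moreover have "boundary_dist (ball 0 1) ((- r) *\<^sub>R ?e) = 1 - r"
      "boundary_dist (ball 0 1) (r *\<^sub>R ?e) = 1 - r"
    using r by (simp_all add: boundary_dist_unit_ball)
  moreover have "(2 * r + (1 - r)) / (1 - r) = t"
  proof -
    have "1 - r = 2 / (t + 1)"
      using t by (simp add: r_def field_simps)
    moreover from this have "2 * r + (1 - r) = 2 - 2 / (t + 1)"
      by linarith
    then have "2 * r + (1 - r) = 2 * t / (t + 1)"
      using t by (simp add: field_simps)
    ultimately show ?thesis using t by simp
  qed
  ultimately show "gromov_metric (ball 0 1) (the (f (Some x))) (the (f (Some y))) = 2 * ln t"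
    using r by (simp add: gromov_metric_def fx fy)
qed

text \<open>At \<open>t = 1\<close> both sides vanish and their derivatives are 1 and \<open>3 c > 1\<close>.\<close>

lemma ln_extremal_ratio:
  fixes c :: real
  assumes c: "c > 1/3"
  obtains t where "t > 1" "ln t < c * ln (2 * t - 1 / t)"
proof -
  let ?g = "\<lambda>t. c * ln (2 * t - 1 / t) - ln t"
  have "(?g has_real_derivative (3 * c - 1)) (at 1)"
    by (auto intro!: derivative_eq_intros)
  then obtain d where d: "d > 0" "\<And>h. h > 0 \<Longrightarrow> h < d \<Longrightarrow> ?g 1 < ?g (1 + h)"
    using DERIV_pos_inc_right[of ?g "3 * c - 1" 1] c by auto
  define t where "t = 1 + d / 2"
  have "t > 1" "?g 1 < ?g t"
    unfolding t_def using d(1) d(2)[of "d / 2"] by auto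
  then show thesis using that[of t] by simp
qed

theorem theorem6p4:
  fixes k :: "'n::finite"
  assumes "CARD('n) \<ge> 2"
  shows
    "(\<forall>f. moebius_half_space_to_ball k f \<longrightarrow>
        (\<forall>x\<in>upper_half_space k. \<forall>y\<in>upper_half_space k.
           1/3 * gromov_metric (upper_half_space k) x y
             \<le> gromov_metric (ball 0 1) (the (f (Some x))) (the (f (Some y))) \<and>
           gromov_metric (ball 0 1) (the (f (Some x))) (the (f (Some y)))
             \<le> 3 * gromov_metric (upper_half_space k) x y)) \<and>
     (\<forall>c::real. c > 1/3 \<longrightarrow>
        \<not> (\<forall>f. moebius_half_space_to_ball k f \<longrightarrow>
              (\<forall>x\<in>upper_half_space k. \<forall>y\<in>upper_half_space k.
                 c * gromov_metric (upper_half_space k) x y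
                   \<le> gromov_metric (ball 0 1) (the (f (Some x))) (the (f (Some y))))))"
proof (intro conjI allI impI)
  show "\<forall>x\<in>upper_half_space k. \<forall>y\<in>upper_half_space k.
           1/3 * gromov_metric (upper_half_space k) x y
             \<le> gromov_metric (ball 0 1) (the (f (Some x))) (the (f (Some y))) \<and>
           gromov_metric (ball 0 1) (the (f (Some x))) (the (f (Some y)))
             \<le> 3 * gromov_metric (upper_half_space k) x y"
    if "moebius_half_space_to_ball k f" for f
    using half_space_to_ball_bounds[OF assms that] by blast
next
  fix c :: real
  assume "c > 1/3"
  then obtain t where t: "t > 1" "ln t < c * ln (2 * t - 1 / t)"
    by (rule ln_extremal_ratio)
  let ?f = "sphere_reflection (- axis k 1 :: real ^ 'n) (sqrt 2)"
  let ?x = "t *\<^sub>R axis k 1 :: real ^ 'n"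
  let ?y = "(1 / t) *\<^sub>R axis k 1 :: real ^ 'n"
  have "?x \<in> upper_half_space k" "?y \<in> upper_half_space k"
    using t by (simp_all add: upper_half_space_def)
  moreover have "\<not> c * gromov_metric (upper_half_space k) ?x ?y
      \<le> gromov_metric (ball 0 1) (the (?f (Some ?x))) (the (?f (Some ?y)))"
    using t(2) unfolding gromov_metric_extremal_pair[OF t(1)] by simp
  ultimately show "\<not> (\<forall>f. moebius_half_space_to_ball k f \<longrightarrow>
              (\<forall>x\<in>upper_half_space k. \<forall>y\<in>upper_half_space k.
                 c * gromov_metric (upper_half_space k) x y
                   \<le> gromov_metric (ball 0 1) (the (f (Some x))) (the (f (Some y)))))"
    using sphere_reflection_half_space_to_ball[of k] by blast
qed

end
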